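(* The operator $I^R$ is not definable in $\mathcal{L}(I)$ over the class of all bi-frames $\langle S,R,R^\bullet\rangle$ satisfying the condition $R\subseteq R^\bullet$.
   Context: Language. Fix a nonempty set $\mathbf{P}$ of propositional variables. The formulas of the language $\mathbf{IRI}$ are given by $\varphi::=p\mid\neg\varphi\mid(\varphi\land\varphi)\mid I\varphi\mid I^R\varphi$ with $p\in\mathbf{P}$; other Boolean connectives are defined as usual. $\mathcal{L}(I)$ is the fragment of $\mathbf{IRI}$ without the construct $I^R\varphi$. Bi-semantics. A bi-frame is a triple $\langle S,R,R^\bullet\rangle$ with $S$ a nonempty set and $R,R^\bullet$ binary relations on $S$; a bi-model $\mathcal{M}=\langle S,R,R^\bullet,V\rangle$ is a bi-frame with a valuation $V:\mathbf{P}\to\mathcal{P}(S)$. Truth at $s\in S$: $\mathcal{M},s\vDash p$ iff $s\in V(p)$; $\neg,\land$ are interpreted classically; $\mathcal{M},s\vDash I\varphi$ iff there is $t$ with $sRt$ and $\mathcal{M},t\vDash\varphi$, and there is $u$ with $sRu$ and $\mathcal{M},u\nvDash\varphi$; $\mathcal{M},s\vDash I^R\varphi$ iff $\mathcal{M},s\vDash I\varphi$ and there is $t$ with $sR^\bullet t$ and $\mathcal{M},t\nvDash I\varphi$. Definability. $I^R$ is definable in $\mathcal{L}(I)$ over a class $F$ of bi-frames if for every $\varphi\in\mathcal{L}(I)$ there is $\psi\in\mathcal{L}(I)$ such that $I^R\varphi\leftrightarrow\psi$ is true at every state of every bi-model based on a bi-frame in $F$. *)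

theory Defs
  imports Main
begin

(* The nonempty set of propositional variables is the type 'p (types are nonempty). *)
datatype 'p form =
    Atom 'p
  | Neg "'p form"
  | Conj "'p form" "'p form"
  | Ign "'p form"     (* I *)
  | IgnR "'p form"    (* I^R *)

definition Imp :: "'p form \<Rightarrow> 'p form \<Rightarrow> 'p form" where
  "Imp \<phi> \<psi> = Neg (Conj \<phi> (Neg \<psi>))"

definition Iff :: "'p form \<Rightarrow> 'p form \<Rightarrow> 'p form" where
  "Iff \<phi> \<psi> = Conj (Imp \<phi> \<psi>) (Imp \<psi> \<phi>)"

inductive_set LI :: "'p form set" where
  "Atom p \<in> LI"
| "\<phi> \<in> LI \<Longrightarrow> Neg \<phi> \<in> LI"
| "\<phi> \<in> LI \<Longrightarrow> \<psi> \<in> LI \<Longrightarrow> Conj \<phi> \<psi> \<in> LI"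
| "\<phi> \<in> LI \<Longrightarrow> Ign \<phi> \<in> LI"

record 's biframe =
  states :: "'s set"
  rel :: "('s \<times> 's) set"
  brel :: "('s \<times> 's) set"    (* the relation R with a bullet *)

record ('s, 'p) bimodel = "'s biframe" +
  val :: "'p \<Rightarrow> 's set"

(* Stated for the extensible record scheme, so that it also applies to bi-models. *)
definition is_biframe :: "('s, 'z) biframe_scheme \<Rightarrow> bool" where
  "is_biframe F \<longleftrightarrow> states F \<noteq> {} \<and> rel F \<subseteq> states F \<times> states F
     \<and> brel F \<subseteq> states F \<times> states F"

definition is_bimodel :: "('s, 'p) bimodel \<Rightarrow> bool" where
  "is_bimodel M \<longleftrightarrow> is_biframe M \<and> (\<forall>p. val M p \<subseteq> states M)"

definition based_on :: "('s, 'p) bimodel \<Rightarrow> 's biframe \<Rightarrow> bool" where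
  "based_on M F \<longleftrightarrow> is_bimodel M \<and> biframe.truncate M = F"

primrec sat :: "('s, 'p) bimodel \<Rightarrow> 's \<Rightarrow> 'p form \<Rightarrow> bool" where
  "sat M s (Atom p) \<longleftrightarrow> s \<in> val M p"
| "sat M s (Neg \<phi>) \<longleftrightarrow> \<not> sat M s \<phi>"
| "sat M s (Conj \<phi> \<psi>) \<longleftrightarrow> sat M s \<phi> \<and> sat M s \<psi>"
| "sat M s (Ign \<phi>) \<longleftrightarrow>
     (\<exists>t. (s, t) \<in> rel M \<and> sat M t \<phi>) \<and> (\<exists>u. (s, u) \<in> rel M \<and> \<not> sat M u \<phi>)"
| "sat M s (IgnR \<phi>) \<longleftrightarrow>
     ((\<exists>t. (s, t) \<in> rel M \<and> sat M t \<phi>) \<and> (\<exists>u. (s, u) \<in> rel M \<and> \<not> sat M u \<phi>))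
     \<and> (\<exists>t. (s, t) \<in> brel M \<and>
          \<not> ((\<exists>v. (t, v) \<in> rel M \<and> sat M v \<phi>) \<and> (\<exists>u. (t, u) \<in> rel M \<and> \<not> sat M u \<phi>)))"

(* The clause for IgnR spells out the truth condition of Ign to keep the recursion
   structural; this is the intended form. *)
lemma sat_IgnR:
  "sat M s (IgnR \<phi>) \<longleftrightarrow>
     sat M s (Ign \<phi>) \<and> (\<exists>t. (s, t) \<in> brel M \<and> \<not> sat M t (Ign \<phi>))"
  by simp

definition IgnR_definable_in :: "'p form set \<Rightarrow> 's biframe set \<Rightarrow> bool" where
  "IgnR_definable_in L C \<longleftrightarrow>
     (\<forall>\<phi>\<in>L. \<exists>\<psi>\<in>L. \<forall>F\<in>C. \<forall>M. based_on M F \<longrightarrow>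
        (\<forall>s\<in>states M. sat M s (Iff (IgnR \<phi>) \<psi>)))"

(* HOL cannot quantify over bi-frames of every state type at once, so the class of all
   bi-frames with R included in R-bullet is taken relative to a state type 's; the state
   sets are arbitrary nonempty subsets of it. *)
definition subrel_biframes :: "'s biframe set" where
  "subrel_biframes = {F. is_biframe F \<and> rel F \<subseteq> brel F}"

end

theory Submission
  imports Defs
begin

text \<open>Formulas of \<open>LI\<close> do not see the second relation, so it suffices to find two bi-models that
  differ only there and disagree on \<open>IgnR (Atom p)\<close>. Let \<open>a\<close> and \<open>b\<close> see each other and
  themselves, let \<open>c\<close> see nothing, and let every atom hold exactly at \<open>a\<close>. Then \<open>Ign (Atom p)\<close>
  holds at \<open>a\<close> and \<open>b\<close> but not at \<open>c\<close>, so adding the pair \<open>(a, c)\<close> to the second relation makes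
  \<open>IgnR (Atom p)\<close> true at \<open>a\<close>.\<close>

text \<open>Only the clause for \<open>IgnR\<close> reads \<open>brel\<close>. The state stays
  arbitrary because the \<open>Ign\<close> case passes to successors.\<close>

lemma sat_LI_cong:
  assumes "\<phi> \<in> LI" "rel M = rel N" "val M = val N"
  shows "sat M s \<phi> \<longleftrightarrow> sat N s \<phi>"
  using assms by (induction arbitrary: s rule: LI.induct) simp_all

lemma sat_Iff: "sat M s (Iff \<phi> \<psi>) \<longleftrightarrow> (sat M s \<phi> \<longleftrightarrow> sat M s \<psi>)"
  by (auto simp: Iff_def Imp_def)

theorem proposition8:
  assumes "infinite (UNIV :: 's set)"
  shows "\<not> IgnR_definable_in (LI :: 'p form set) (subrel_biframes :: 's biframe set)"
proof
  assume "IgnR_definable_in (LI :: 'p form set) (subrel_biframes :: 's biframe set)"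
  moreover fix p :: 'p
  have "Atom p \<in> LI"
    by (rule LI.intros)
  ultimately obtain \<psi> :: "'p form" where \<psi>: "\<psi> \<in> LI"
    and def: "\<And>F (M :: ('s, 'p) bimodel) s. F \<in> subrel_biframes \<Longrightarrow> based_on M F \<Longrightarrow>
      s \<in> states M \<Longrightarrow> sat M s (IgnR (Atom p)) \<longleftrightarrow> sat M s \<psi>"
    unfolding IgnR_definable_in_def sat_Iff by blast
  obtain a b c :: 's where distinct: "a \<noteq> b" "a \<noteq> c" "b \<noteq> c"
    using infinite_arbitrarily_large[OF assms, of 3] by (auto simp: card_3_iff)
  define R where "R = {a, b} \<times> {a, b}"
  \<comment> \<open>With \<open>UNIV\<close> as state set, any \<open>Q\<close> containing
    \<open>R\<close> gives a bi-frame of the class.\<close>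
  define M :: "('s \<times> 's) set \<Rightarrow> ('s, 'p) bimodel"
    where "M Q = \<lparr>states = UNIV, rel = R, brel = Q, val = \<lambda>_. {a}\<rparr>" for Q
  have iff: "sat (M Q) a (IgnR (Atom p)) \<longleftrightarrow> sat (M Q) a \<psi>" if "R \<subseteq> Q" for Q
  proof (rule def)
    show "biframe.truncate (M Q) \<in> subrel_biframes"
      using that by (simp add: M_def subrel_biframes_def is_biframe_def biframe.truncate_def)
    show "based_on (M Q) (biframe.truncate (M Q))"
      by (simp add: M_def based_on_def is_bimodel_def is_biframe_def)
  qed (simp add: M_def)
  \<comment> \<open>Both \<open>brel\<close>-successors of \<open>a\<close>, namely \<open>a\<close>
    and \<open>b\<close>, see \<open>a\<close>, where \<open>p\<close> holds, and \<open>b\<close>,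
    where it fails.\<close>
  have "\<not> sat (M R) a (IgnR (Atom p))"
    using distinct by (auto simp: M_def R_def)
  \<comment> \<open>\<open>Ign (Atom p)\<close> fails at \<open>c\<close> for want of any
    \<open>rel\<close>-successor.\<close>
  moreover have "sat (M (insert (a, c) R)) a (IgnR (Atom p))"
    using distinct by (auto simp: M_def R_def)
  moreover have "sat (M R) a \<psi> \<longleftrightarrow> sat (M (insert (a, c) R)) a \<psi>"
    using \<psi> by (rule sat_LI_cong) (simp_all add: M_def)
  ultimately show False
    using iff[of R] iff[of "insert (a, c) R"] by blast
qed

end
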